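(* Let $q$ be a prime power, let $C$ be an $\mathbb{F}_q$-linear code of length $n$, let $1\le d\le n$, let $f\in\mathrm{Harm}_d(n)$, and let $m$ be a positive integer. Then $$Z_{C,f}(x,y;q^m)=(-1)^{d}\sum_{t=d}^{n-d}B_{t,f}^{q^m}(C)\,(x-y)^{t-d}\,y^{n-t-d}.$$
   Context: Let $E=\{1,\dots,n\}$ and let $E_t$ be the set of $t$-element subsets of $E$. $\mathrm{Harm}_d(n)$ is the space of functions $f:E_d\to\mathbb{R}$ such that $\sum_{Z\in E_d,\,Y\subseteq Z}f(Z)=0$ for every $Y\in E_{d-1}$. For $X\subseteq E$ put $\widetilde f(X)=\sum_{Z\in E_d,\,Z\subseteq X}f(Z)$. An $\mathbb{F}_q$-linear code of length $n$ is a linear subspace of $\mathbb{F}_q^n$. For a vector $\mathbf u$, $\mathrm{supp}(\mathbf u)=\{i\in E: u_i\ne 0\}$ and $\mathrm{wt}(\mathbf u)=|\mathrm{supp}(\mathbf u)|$. For a positive integer $m$, $C[q^m]=C\otimes\mathbb{F}_{q^m}\subseteq\mathbb{F}_{q^m}^n$ is the $\mathbb{F}_{q^m}$-linear span of $C$, and $$A_{i,f}^{q^m}(C)=\sum_{\mathbf u\in C[q^m],\ \mathrm{wt}(\mathbf u)=i}\widetilde f(\mathrm{supp}(\mathbf u)).$$ The harmonic $q^m$-extended weight enumerator is $W_{C,f}(x,y;q^m)=\sum_{i=0}^nA_{i,f}^{q^m}(C)x^{n-i}y^i$; it equals $(xy)^dZ_{C,f}(x,y;q^m)$, where $$Z_{C,f}(x,y;q^m)=\sum_{i=d}^{n-d}A_{i,f}^{q^m}(C)\,x^{n-i-d}y^{i-d}$$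 (an empty sum is $0$). For $X\subseteq E$ let $C(X)=\{\mathbf u\in C: u_i=0\text{ for all }i\in X\}$, $\ell(X)=\dim_{\mathbb{F}_q}C(X)$, $B_X^{q^m}(C)=(q^m)^{\ell(X)}-1$, and $B_{t,f}^{q^m}(C)=\sum_{X\in E_t}\widetilde f(X)B_X^{q^m}(C)$. *)

theory Defs
  imports "HOL-Analysis.Analysis" "HOL-Computational_Algebra.Polynomial"
begin

(* The coordinate set E is the finite index type 'n, so n = CARD('n); F_q is the type 'a and
   F_(q^m) is the type 'b, both of class {field, finite}. The F_q-linear codes of length n are
   the C :: ('a^'n) set with vec.subspace C. *)

abbreviation E_sets :: "nat \<Rightarrow> 'n::finite set set" where
  "E_sets t \<equiv> {X. card X = t}"

(* Only the values of f on E_sets d matter; a function on E_sets d is represented by any of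
   its extensions to all sets. The value Harm 0 is not meaningful (d - 1 truncates). *)
definition Harm :: "nat \<Rightarrow> ('n::finite set \<Rightarrow> real) set" where
  "Harm d = {f. \<forall>Y\<in>E_sets (d - 1). (\<Sum>Z | Z \<in> E_sets d \<and> Y \<subseteq> Z. f Z) = 0}"

definition tilde :: "nat \<Rightarrow> ('n::finite set \<Rightarrow> real) \<Rightarrow> 'n set \<Rightarrow> real" where
  "tilde d f X = (\<Sum>Z | Z \<in> E_sets d \<and> Z \<subseteq> X. f Z)"

definition supp :: "('a::zero)^'n::finite \<Rightarrow> 'n set" where
  "supp u = {i. u $ i \<noteq> 0}"

definition wt :: "('a::zero)^'n::finite \<Rightarrow> nat" where
  "wt u = card (supp u)"

(* Injectivity is automatic for a unital homomorphism of fields. *)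
definition field_embedding :: "('a::field \<Rightarrow> 'b::field) \<Rightarrow> bool" where
  "field_embedding \<iota> \<longleftrightarrow>
     \<iota> 1 = 1 \<and> (\<forall>a b. \<iota> (a + b) = \<iota> a + \<iota> b) \<and> (\<forall>a b. \<iota> (a * b) = \<iota> a * \<iota> b)"

(* C[q^m], where \<iota> is the embedding of F_q into F_(q^m) and vec.span is taken over F_(q^m). *)
definition ext_code ::
    "('a::field \<Rightarrow> 'b::field) \<Rightarrow> ('a^'n::finite) set \<Rightarrow> ('b^'n) set" where
  "ext_code \<iota> C = vec.span ((\<lambda>u. \<chi> i. \<iota> (u $ i)) ` C)"

definition A_coeff ::
    "('a::field \<Rightarrow> 'b::{field,finite}) \<Rightarrow> nat \<Rightarrow> ('a^'n::finite) set \<Rightarrow> ('n set \<Rightarrow> real)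
      \<Rightarrow> nat \<Rightarrow> real" where
  "A_coeff \<iota> d C f i = (\<Sum>u | u \<in> ext_code \<iota> C \<and> wt u = i. tilde d f (supp u))"

(* R[x,y] is represented as R[x][y]: polynomials in y whose coefficients are polynomials in x. *)

abbreviation pvar_x :: "real poly poly" where
  "pvar_x \<equiv> [:[:0, 1:]:]"

abbreviation pvar_y :: "real poly poly" where
  "pvar_y \<equiv> [:0, 1:]"

abbreviation pconst :: "real \<Rightarrow> real poly poly" where
  "pconst a \<equiv> [:[:a:]:]"

definition Z_poly ::
    "('a::field \<Rightarrow> 'b::{field,finite}) \<Rightarrow> nat \<Rightarrow> ('a^'n::finite) set \<Rightarrow> ('n set \<Rightarrow> real)
      \<Rightarrow> real poly poly" where
  "Z_poly \<iota> d C f =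
     (\<Sum>i = d..CARD('n) - d.
        pconst (A_coeff \<iota> d C f i) * pvar_x ^ (CARD('n) - i - d) * pvar_y ^ (i - d))"

definition shortened :: "('a::zero^'n::finite) set \<Rightarrow> 'n set \<Rightarrow> ('a^'n) set" where
  "shortened C X = {u \<in> C. \<forall>i\<in>X. u $ i = 0}"

definition ell :: "('a::field^'n::finite) set \<Rightarrow> 'n set \<Rightarrow> nat" where
  "ell C X = vec.dim (shortened C X)"

(* In the two definitions below, Q stands for q^m. *)

definition B_set :: "nat \<Rightarrow> ('a::field^'n::finite) set \<Rightarrow> 'n set \<Rightarrow> real" where
  "B_set Q C X = real Q ^ ell C X - 1"

definition B_coeff ::
    "nat \<Rightarrow> nat \<Rightarrow> ('a::field^'n::finite) set \<Rightarrow> ('n set \<Rightarrow> real) \<Rightarrow> nat \<Rightarrow> real" where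
  "B_coeff Q d C f t = (\<Sum>X\<in>E_sets t. tilde d f X * B_set Q C X)"

end

theory Submission
  imports Defs
begin

text \<open>
  Write \<open>n = CARD('n)\<close> and \<open>D = ext_code \<iota> C\<close>. Three facts carry the proof.

  \<^item> For every set \<open>X\<close> of coordinates, the number of \<open>u \<in> D\<close> that vanish on \<open>X\<close> is
    \<open>CARD('b) ^ ell C X\<close> (\<open>card_shortened_ext_code\<close>). So \<open>B_set CARD('b) C X\<close> counts the nonzero
    \<open>u \<in> D\<close> with \<open>X \<subseteq> - supp u\<close>.

  \<^item> For every \<open>S\<close> and \<open>t \<ge> d\<close>, the sum of \<open>tilde d f X\<close> over the \<open>t\<close>-subsets \<open>X\<close> of \<open>S\<close> is
    \<open>tilde d f S\<close> times a binomial coefficient that depends only on \<open>card S\<close>, \<open>t\<close> and \<open>d\<close>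
    (\<open>sum_tilde_subsets\<close>).

  \<^item> Harmonicity makes \<open>tilde d f\<close> invariant under complementation up to the sign \<open>(-1) ^ d\<close>
    (\<open>tilde_Compl\<close>).

  Exchanging the sums over \<open>X\<close> and \<open>u\<close> in \<open>B_coeff\<close>, the first two facts express it through the values
  \<open>tilde d f (- supp u)\<close>, and the third turns these into \<open>tilde d f (supp u)\<close>. This is the source of the
  sign in the theorem. Grouping the codewords by weight gives \<open>B_coeff_eq_sum_A_coeff\<close>: up to the
  sign, \<open>B_coeff\<close> at \<open>t\<close> is the sum of the \<open>A_coeff\<close> at \<open>i\<close> with weights
  \<open>(n - i - d) choose (t - d)\<close>. With these weights the sum over \<open>t\<close> on the right-hand side of the theorem is,
  for each \<open>i\<close>, the binomial expansion of a power of \<open>x = (x - y) + y\<close>, and what remains is the monomial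
  that accompanies \<open>A_coeff\<close> at \<open>i\<close> in \<open>Z_poly\<close>.
\<close>

section \<open>Harmonic functions\<close>

text \<open>
  The definition gives the case \<open>card Y = d - 1\<close>. A smaller \<open>Y\<close> is enlarged by one point \<open>i\<close> in all
  possible ways: each \<open>d\<close>-set \<open>Z \<supseteq> Y\<close> is then counted once for each \<open>i \<in> Z - Y\<close>, that is \<open>d - card Y\<close>
  times, and this factor is nonzero.
\<close>

lemma Harm_sum_supersets_eq_0:
  fixes f :: "'n::finite set \<Rightarrow> real"
  assumes "f \<in> Harm d" and "card Y < d"
  shows "(\<Sum>Z | card Z = d \<and> Y \<subseteq> Z. f Z) = 0"
  using assms(2)
proof (induction "d - 1 - card Y" arbitrary: Y)
  case 0
  then have "card Y = d - 1" by simp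
  with assms(1) show ?case by (simp add: Harm_def)
next
  case (Suc k)
  have IH: "(\<Sum>Z | card Z = d \<and> insert i Y \<subseteq> Z. f Z) = 0" if "i \<in> - Y" for i
    using Suc.hyps(2) Suc.prems that by (intro Suc.hyps(1)) auto
  have "real (d - card Y) * (\<Sum>Z | card Z = d \<and> Y \<subseteq> Z. f Z)
      = (\<Sum>Z | card Z = d \<and> Y \<subseteq> Z. \<Sum>i\<in>Z - Y. f Z)"
    unfolding sum_distrib_left by (intro sum.cong) (auto simp: card_Diff_subset)
  also have "\<dots> = (\<Sum>Z | card Z = d \<and> Y \<subseteq> Z. \<Sum>i | i \<in> - Y \<and> i \<in> Z. f Z)"
    by (intro sum.cong) auto
  also have "\<dots> = (\<Sum>i\<in>- Y. \<Sum>Z | Z \<in> {Z. card Z = d \<and> Y \<subseteq> Z} \<and> i \<in> Z. f Z)"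
    by (rule sum.swap_restrict) auto
  also have "\<dots> = (\<Sum>i\<in>- Y. \<Sum>Z | card Z = d \<and> insert i Y \<subseteq> Z. f Z)"
    by (intro sum.cong refl arg_cong[where f = "sum f"]) auto
  also have "\<dots> = 0"
    using IH by simp
  finally show ?case
    using Suc.prems by simp
qed

text \<open>
  Inclusion-exclusion: the condition \<open>Z \<inter> X = {}\<close> is replaced by the alternating sum over all
  \<open>Y \<subseteq> X \<inter> Z\<close>. After exchanging the sums, \<open>Y\<close> contributes the sum of \<open>f\<close> over the \<open>d\<close>-sets above it, which
  is \<open>0\<close> by harmonicity if \<open>card Y < d\<close> and empty if \<open>card Y > d\<close>. Only the \<open>d\<close>-subsets \<open>Y\<close> of \<open>X\<close>
  survive, all with the sign \<open>(-1) ^ d\<close>.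
\<close>

lemma tilde_Compl:
  fixes f :: "'n::finite set \<Rightarrow> real"
  assumes "f \<in> Harm d"
  shows "tilde d f (- X) = (-1) ^ d * tilde d f X"
proof -
  have alt: "(\<Sum>Y | Y \<subseteq> X \<and> Y \<subseteq> Z. (-1) ^ card Y) = (if Z \<subseteq> - X then 1 else 0 :: real)" for Z
  proof -
    have "(\<Prod>i\<in>X \<inter> Z. 1 - 1 :: real) = (\<Sum>Y\<in>Pow (X \<inter> Z). (-1) ^ card Y)"
      using prod_diff_conv_sum[of "X \<inter> Z" "\<lambda>_. 1 :: real" "\<lambda>_. 1"] by simp
    moreover have "Pow (X \<inter> Z) = {Y. Y \<subseteq> X \<and> Y \<subseteq> Z}" by auto
    moreover have "(\<Prod>i\<in>X \<inter> Z. 1 - 1 :: real) = (if Z \<subseteq> - X then 1 else 0)"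
      by (cases "X \<inter> Z = {}") (auto simp: card_eq_0_iff)
    ultimately show ?thesis by simp
  qed
  have vanish: "(\<Sum>Z | card Z = d \<and> Y \<subseteq> Z. f Z) = (if card Y = d then f Y else 0)" for Y
  proof -
    consider "card Y < d" | "card Y = d" | "card Y > d" by linarith
    then show ?thesis
    proof cases
      case 1
      with Harm_sum_supersets_eq_0[OF assms] show ?thesis by simp
    next
      case 2
      then have "{Z. card Z = d \<and> Y \<subseteq> Z} = {Y}"
        using card_subset_eq[OF finite, of Y] by blast
      with 2 show ?thesis by simp
    next
      case 3
      then have "{Z. card Z = d \<and> Y \<subseteq> Z} = {}"
        by (auto dest: card_mono[OF finite])
      with 3 show ?thesis by (metis less_irrefl sum.empty)
    qed
  qed
  have "tilde d f (- X) = (\<Sum>Z | card Z = d. if Z \<subseteq> - X then f Z else 0)"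
    by (simp add: tilde_def sum.If_cases Collect_conj_eq)
  also have "\<dots> = (\<Sum>Z | card Z = d. \<Sum>Y | Y \<in> Pow X \<and> Y \<subseteq> Z. (-1) ^ card Y * f Z)"
    by (intro sum.cong refl) (simp add: alt flip: sum_distrib_right)
  also have "\<dots> = (\<Sum>Y\<in>Pow X. \<Sum>Z | Z \<in> {Z. card Z = d} \<and> Y \<subseteq> Z. (-1) ^ card Y * f Z)"
    by (rule sum.swap_restrict) auto
  also have "\<dots> = (\<Sum>Y\<in>Pow X. if card Y = d then (-1) ^ d * f Y else 0)"
    by (intro sum.cong refl) (simp add: vanish flip: sum_distrib_left)
  also have "\<dots> = (-1) ^ d * tilde d f X"
    by (simp add: tilde_def sum.If_cases sum_distrib_left Int_def conj_commute)
  finally show ?thesis .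
qed

lemma tilde_eq_0_if_card_less:
  fixes X :: "'n::finite set"
  assumes "card X < d"
  shows "tilde d f X = 0"
proof -
  have "{Z. Z \<in> E_sets d \<and> Z \<subseteq> X} = {}"
    using assms by (auto dest: card_mono[OF finite])
  then show ?thesis unfolding tilde_def by (metis sum.empty)
qed

lemma card_between:
  fixes S :: "'n::finite set"
  assumes "Z \<subseteq> S" and "card Z \<le> t"
  shows "card {X. card X = t \<and> Z \<subseteq> X \<and> X \<subseteq> S} = (card S - card Z) choose (t - card Z)"
proof -
  have "bij_betw (\<lambda>W. W \<union> Z) {W. W \<subseteq> S - Z \<and> card W = t - card Z}
      {X. card X = t \<and> Z \<subseteq> X \<and> X \<subseteq> S}"
  proof (rule bij_betw_byWitness[where f' = "\<lambda>X. X - Z"])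
    show "(\<lambda>W. W \<union> Z) ` {W. W \<subseteq> S - Z \<and> card W = t - card Z}
        \<subseteq> {X. card X = t \<and> Z \<subseteq> X \<and> X \<subseteq> S}"
      using assms by (auto simp: card_Un_disjoint[OF finite finite] disjoint_iff subset_iff)
  qed (auto simp: card_Diff_subset assms)
  from bij_betw_same_card[OF this] show ?thesis
    by (simp add: n_subsets card_Diff_subset assms)
qed

text \<open>
  Double counting: each \<open>d\<close>-set \<open>Z \<subseteq> S\<close> lies in the same number of \<open>t\<close>-sets \<open>X \<subseteq> S\<close>. If \<open>card S < d\<close>, the
  truncated difference \<open>card S - d\<close> does no harm, since there is no such \<open>Z\<close> and
  both sides are \<open>0\<close>.
\<close>

lemma sum_tilde_subsets:
  fixes S :: "'n::finite set"
  assumes "d \<le> t"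
  shows "(\<Sum>X | card X = t \<and> X \<subseteq> S. tilde d f X)
    = real ((card S - d) choose (t - d)) * tilde d f S"
proof -
  have "(\<Sum>X | card X = t \<and> X \<subseteq> S. tilde d f X)
      = (\<Sum>X | card X = t \<and> X \<subseteq> S. \<Sum>Z | Z \<in> {Z. card Z = d \<and> Z \<subseteq> S} \<and> Z \<subseteq> X. f Z)"
    unfolding tilde_def by (intro sum.cong refl arg_cong[where f = "sum f"]) auto
  also have "\<dots> = (\<Sum>Z | card Z = d \<and> Z \<subseteq> S.
      \<Sum>X | X \<in> {X. card X = t \<and> X \<subseteq> S} \<and> Z \<subseteq> X. f Z)"
    by (rule sum.swap_restrict) auto
  also have "\<dots> = (\<Sum>Z | card Z = d \<and> Z \<subseteq> S. real ((card S - d) choose (t - d)) * f Z)"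
  proof (intro sum.cong refl)
    fix Z assume Z: "Z \<in> {Z. card Z = d \<and> Z \<subseteq> S}"
    have "{X. X \<in> {X. card X = t \<and> X \<subseteq> S} \<and> Z \<subseteq> X} = {X. card X = t \<and> Z \<subseteq> X \<and> X \<subseteq> S}"
      by auto
    then show "(\<Sum>X | X \<in> {X. card X = t \<and> X \<subseteq> S} \<and> Z \<subseteq> X. f Z)
        = real ((card S - d) choose (t - d)) * f Z"
      using Z assms card_between[of Z S t] by simp
  qed
  also have "\<dots> = real ((card S - d) choose (t - d)) * tilde d f S"
    by (simp add: tilde_def sum_distrib_left)
  finally show ?thesis .
qed

section \<open>Counting codewords of an extended code\<close>

lemma (in vector_space) bij_betw_span_coordinates:
  assumes "independent B" and "finite B"
  shows "bij_betw (\<lambda>c. \<Sum>b\<in>B. c b *s b) (B \<rightarrow>\<^sub>E UNIV) (span B)"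
proof (rule bij_betwI[where g = "\<lambda>v. restrict (representation B v) B"])
  show "(\<lambda>c. \<Sum>b\<in>B. c b *s b) \<in> (B \<rightarrow>\<^sub>E UNIV) \<rightarrow> span B"
    by (auto intro: span_sum span_scale span_base)
  show "(\<lambda>v. restrict (representation B v) B) \<in> span B \<rightarrow> (B \<rightarrow>\<^sub>E UNIV)"
    by auto
  show "restrict (representation B (\<Sum>b\<in>B. c b *s b)) B = c" if "c \<in> B \<rightarrow>\<^sub>E UNIV" for c
  proof
    fix b
    have "representation B (\<Sum>b\<in>B. c b *s b) b = c b" if "b \<in> B"
      using that assms
      by (simp add: representation_sum representation_scale representation_basis
          span_scale span_base sum.delta if_distrib cong: if_cong)
    then show "restrict (representation B (\<Sum>b\<in>B. c b *s b)) B b = c b"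
      using \<open>c \<in> B \<rightarrow>\<^sub>E UNIV\<close> by (auto simp: restrict_def PiE_def extensional_def)
  qed
  show "(\<Sum>b\<in>B. restrict (representation B v) B b *s b) = v" if "v \<in> span B" for v
    using that assms by (simp add: sum_representation_eq)
qed

lemma (in vector_space) card_span_independent:
  assumes "independent B" and "finite B"
  shows "card (span B) = CARD('a) ^ card B"
  using bij_betw_same_card[OF bij_betw_span_coordinates[OF assms]] assms(2)
  by (simp add: card_funcsetE)

lemma card_subspace_vec:
  fixes C :: "('a::{field,finite}^'n::finite) set"
  assumes "vec.subspace C"
  shows "card C = CARD('a) ^ vec.dim C"
proof -
  obtain B where "B \<subseteq> C" "vec.independent B" "C \<subseteq> vec.span B" "card B = vec.dim C"
    using vec.basis_exists by blast
  moreover from this have "vec.span B = C"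
    using assms vec.span_subspace by blast
  ultimately show ?thesis
    using vec.card_span_independent[of B] by simp
qed

lemma subspace_shortened:
  assumes "vec.subspace C"
  shows "vec.subspace (shortened C X)"
  using assms by (auto simp: vec.subspace_def shortened_def)

lemma field_embedding_0:
  assumes "field_embedding \<iota>"
  shows "\<iota> 0 = 0"
  using assms unfolding field_embedding_def by (metis add.right_neutral add_left_cancel)

lemma vector_space_field_embedding:
  assumes "field_embedding \<iota>"
  shows "vector_space (\<lambda>a x. \<iota> a * x)"
  using assms unfolding field_embedding_def by unfold_locales (auto simp: algebra_simps)

text \<open>
  Codewords of the extended code have coordinates over the small field that again form codewords. The
  map \<open>\<phi>\<close> stands for any functional on the large field that is linear over the small one; it is not
  linear over the large field, so the vectors with the claimed property for this single \<open>\<phi>\<close> are not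
  visibly a subspace. The set \<open>W\<close> of the proof asks for the property for all the functionals
  \<open>\<lambda>x. \<phi> (\<mu> * x)\<close> at once and is therefore closed under scalars of the large field.
\<close>

lemma coordinates_ext_code:
  fixes \<iota> :: "'a::field \<Rightarrow> 'b::field" and C :: "('a^'n::finite) set"
  assumes C: "vec.subspace C"
    and w: "w \<in> ext_code \<iota> C"
    and add: "\<And>x y. \<phi> (x + y) = \<phi> x + \<phi> y" and scale: "\<And>a x. \<phi> (\<iota> a * x) = a * \<phi> x"
  shows "(\<chi> i. \<phi> (w $ i)) \<in> C"
proof -
  define W where "W = {w :: 'b^'n. \<forall>\<mu>. (\<chi> i. \<phi> (\<mu> * w $ i)) \<in> C}"
  have "\<phi> 0 = 0"
    using add[of 0 0] by (metis add.right_neutral add_left_cancel)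
  have "vec.subspace W"
  proof (rule vec.subspaceI)
    have "(\<chi> i. 0) = (0 :: 'a^'n)" by vector
    then show "0 \<in> W"
      using C \<open>\<phi> 0 = 0\<close> vec.subspace_0[OF C] by (simp add: W_def)
  next
    fix x y assume "x \<in> W" "y \<in> W"
    moreover have "(\<chi> i. \<phi> (\<mu> * (x + y) $ i)) = (\<chi> i. \<phi> (\<mu> * x $ i)) + (\<chi> i. \<phi> (\<mu> * y $ i))" for \<mu>
      by (simp add: vec_eq_iff distrib_left add)
    ultimately show "x + y \<in> W"
      using vec.subspace_add[OF C] by (simp add: W_def)
  next
    fix c x assume "x \<in> W"
    then show "c *s x \<in> W"
      by (simp add: W_def flip: mult.assoc)
  qed
  moreover have "(\<lambda>u. \<chi> i. \<iota> (u $ i)) ` C \<subseteq> W"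
  proof (clarsimp simp: W_def)
    fix u \<mu> assume "u \<in> C"
    have "(\<chi> i. \<phi> (\<mu> * \<iota> (u $ i))) = \<phi> \<mu> *s u"
      by (simp add: vec_eq_iff scale mult.commute[of \<mu>] mult.commute[of "\<phi> \<mu>"])
    with \<open>u \<in> C\<close> show "(\<chi> i. \<phi> (\<mu> * \<iota> (u $ i))) \<in> C"
      using vec.subspace_scale[OF C] by simp
  qed
  ultimately have "w \<in> W"
    using w vec.span_minimal unfolding ext_code_def by blast
  then have "(\<chi> i. \<phi> (1 * w $ i)) \<in> C" unfolding W_def by blast
  then show ?thesis by simp
qed

text \<open>
  Let \<open>B\<close> be a basis of the large field over the small one. Writing each entry of a vector \<open>w\<close> in
  this basis splits \<open>w\<close> into vectors over the small field, one for each \<open>b \<in> B\<close>. Then \<open>w\<close> lies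
  in the extended code and vanishes on \<open>X\<close> iff each of these vectors lies in \<open>C\<close> and vanishes on \<open>X\<close>.
  So the extended shortened code has as many elements as there are functions from \<open>B\<close> to the shortened
  code. This argument determines the cardinality without a comparison of dimensions over the two fields.
\<close>

lemma card_shortened_ext_code:
  fixes \<iota> :: "'a::{field,finite} \<Rightarrow> 'b::{field,finite}" and C :: "('a^'n::finite) set"
  assumes \<iota>: "field_embedding \<iota>" and C: "vec.subspace C"
  shows "card (shortened (ext_code \<iota> C) X) = CARD('b) ^ ell C X"
proof -
  interpret E: vector_space "\<lambda>a x. \<iota> a * x"
    by (rule vector_space_field_embedding[OF \<iota>])
  obtain B where "B \<subseteq> UNIV" and indep: "E.independent B" and "UNIV \<subseteq> E.span B"
    by (rule E.maximal_independent_subset[of UNIV])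
  then have span: "E.span B = UNIV" by blast
  define R where "R b x = E.representation B x b" for b x
  have R_add: "R b (x + y) = R b x + R b y" for b x y
    by (simp add: R_def E.representation_add[OF indep] span)
  have R_scale: "R b (\<iota> a * x) = a * R b x" for a b x
    by (simp add: R_def E.representation_scale[OF indep] span)
  have R_0: "R b 0 = 0" for b
    using R_add[of b 0 0] by (metis add.right_neutral add_left_cancel)
  have R_eq: "(\<Sum>b\<in>B. \<iota> (R b x) * b) = x" for x
    unfolding R_def by (rule E.sum_representation_eq[OF indep]) (auto simp: span)
  have R_sum: "R b (\<Sum>b'\<in>B. \<iota> (c b') * b') = c b" if "b \<in> B" for b c
    using that
    by (simp add: R_def E.representation_sum[OF indep] E.representation_scale[OF indep]
        E.representation_basis[OF indep] span sum.delta if_distrib cong: if_cong)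
  define \<Phi> where "\<Phi> u = (\<Sum>b\<in>B. b *s (\<chi> i. \<iota> (u b $ i)))" for u :: "'b \<Rightarrow> 'a^'n"
  have \<Phi>_nth: "\<Phi> u $ i = (\<Sum>b\<in>B. \<iota> (u b $ i) * b)" for u i
    by (simp add: \<Phi>_def mult.commute)
  have "bij_betw \<Phi> (B \<rightarrow>\<^sub>E shortened C X) (shortened (ext_code \<iota> C) X)"
  proof (rule bij_betwI[where g = "\<lambda>w. \<lambda>b\<in>B. \<chi> i. R b (w $ i)"])
    show "\<Phi> \<in> (B \<rightarrow>\<^sub>E shortened C X) \<rightarrow> shortened (ext_code \<iota> C) X"
    proof
      fix u assume u: "u \<in> B \<rightarrow>\<^sub>E shortened C X"
      then have "u b \<in> C" "\<forall>i\<in>X. u b $ i = 0" if "b \<in> B" for b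
        using that by (auto simp: shortened_def PiE_iff)
      moreover from this have "\<Phi> u \<in> ext_code \<iota> C"
        unfolding \<Phi>_def ext_code_def
        by (intro vec.span_sum vec.span_scale vec.span_base imageI)
      ultimately show "\<Phi> u \<in> shortened (ext_code \<iota> C) X"
        by (simp add: shortened_def \<Phi>_nth field_embedding_0[OF \<iota>])
    qed
    show "(\<lambda>w. \<lambda>b\<in>B. \<chi> i. R b (w $ i)) \<in> shortened (ext_code \<iota> C) X \<rightarrow> (B \<rightarrow>\<^sub>E shortened C X)"
      by (auto simp: shortened_def R_0 R_add R_scale intro!: coordinates_ext_code[OF C])
    show "(\<lambda>b\<in>B. \<chi> i. R b (\<Phi> u $ i)) = u" if "u \<in> B \<rightarrow>\<^sub>E shortened C X" for u
    proof
      fix b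
      show "(\<lambda>b\<in>B. \<chi> i. R b (\<Phi> u $ i)) b = u b"
      proof (cases "b \<in> B")
        case True
        then have "R b (\<Phi> u $ i) = u b $ i" for i
          unfolding \<Phi>_nth by (rule R_sum)
        with True show ?thesis by simp
      next
        case False
        then show ?thesis by (simp add: PiE_arb[OF that False])
      qed
    qed
    show "\<Phi> (\<lambda>b\<in>B. \<chi> i. R b (w $ i)) = w" if "w \<in> shortened (ext_code \<iota> C) X" for w
      by (simp add: vec_eq_iff \<Phi>_nth R_eq)
  qed
  then have "card (shortened (ext_code \<iota> C) X) = card (shortened C X) ^ card B"
    using bij_betw_same_card by (fastforce simp: card_funcsetE)
  also have "\<dots> = (CARD('a) ^ card B) ^ ell C X"
    unfolding card_subspace_vec[OF subspace_shortened[OF C]] ell_def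
    by (simp add: mult.commute flip: power_mult)
  also have "CARD('a) ^ card B = CARD('b)"
    using E.card_span_independent[OF indep] span by simp
  finally show ?thesis .
qed

section \<open>The weight enumerator\<close>

text \<open>
  A set \<open>S\<close> with fewer than \<open>d\<close> elements has no \<open>d\<close>-subsets, so \<open>tilde d f S = 0\<close>. If the complement
  of \<open>S\<close> has fewer than \<open>d\<close> elements, \<open>tilde_Compl\<close> gives the same. This is why \<open>Z_poly\<close> loses nothing by
  restricting \<open>i\<close> to \<open>d..n - d\<close>.
\<close>

lemma A_coeff_eq_0:
  fixes C :: "('a::field^'n::finite) set"
  assumes "f \<in> Harm d" and "i < d \<or> CARD('n) < i + d"
  shows "A_coeff \<iota> d C f i = 0"
  unfolding A_coeff_def
proof (rule sum.neutral, clarify)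
  fix u :: "'b^'n" assume "i = wt u"
  then have "card (supp u) < d \<or> card (- supp u) < d"
    using assms(2) card_mono[OF finite subset_UNIV, of "supp u"]
    by (auto simp: wt_def Compl_eq_Diff_UNIV card_Diff_subset)
  then show "tilde d f (supp u) = 0"
  proof
    assume "card (- supp u) < d"
    then have "tilde d f (- supp u) = 0" by (rule tilde_eq_0_if_card_less)
    then show ?thesis by (simp add: tilde_Compl[OF assms(1)])
  qed (rule tilde_eq_0_if_card_less)
qed

text \<open>
  \<open>B_coeff\<close> counts the pairs of a nonzero codeword \<open>u\<close> and a \<open>t\<close>-set \<open>X\<close> disjoint from \<open>supp u\<close>, weighted
  by \<open>tilde d f X\<close>. For a fixed \<open>u\<close> these weights add up to \<open>tilde d f (- supp u)\<close> times the binomial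
  coefficient that belongs to the \<open>n - wt u\<close> coordinates outside \<open>supp u\<close>. Passing from \<open>- supp u\<close> to
  \<open>supp u\<close> produces the sign.
\<close>

lemma B_coeff_eq_sum_A_coeff:
  fixes \<iota> :: "'a::{field,finite} \<Rightarrow> 'b::{field,finite}" and C :: "('a^'n::finite) set"
  assumes \<iota>: "field_embedding \<iota>" and C: "vec.subspace C"
    and d: "1 \<le> d" "d \<le> t" and f: "f \<in> Harm d"
  shows "(-1) ^ d * B_coeff CARD('b) d C f t
    = (\<Sum>i = d..CARD('n) - d. real ((CARD('n) - i - d) choose (t - d)) * A_coeff \<iota> d C f i)"
proof -
  let ?D = "ext_code \<iota> C"
  let ?c = "\<lambda>i. real ((CARD('n) - i - d) choose (t - d))"
  have "0 \<in> ?D"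
    unfolding ext_code_def by (rule vec.span_zero)
  have B: "B_set CARD('b) C X = (\<Sum>u | u \<in> ?D - {0} \<and> X \<subseteq> - supp u. 1)" for X
  proof -
    have "{u. u \<in> ?D - {0} \<and> X \<subseteq> - supp u} = shortened ?D X - {0}"
      by (auto simp: shortened_def supp_def)
    moreover have "0 \<in> shortened ?D X"
      using \<open>0 \<in> ?D\<close> by (simp add: shortened_def)
    ultimately show ?thesis
      using card_shortened_ext_code[OF \<iota> C, of X]
      by (simp add: B_set_def card_Diff_singleton of_nat_diff)
  qed
  have "B_coeff CARD('b) d C f t
      = (\<Sum>X\<in>E_sets t. \<Sum>u | u \<in> ?D - {0} \<and> X \<subseteq> - supp u. tilde d f X)"
    unfolding B_coeff_def B by (simp add: mult.commute)
  also have "\<dots> = (\<Sum>u\<in>?D - {0}. \<Sum>X | X \<in> E_sets t \<and> X \<subseteq> - supp u. tilde d f X)"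
    by (rule sum.swap_restrict) auto
  also have "\<dots> = (\<Sum>u\<in>?D - {0}. ?c (wt u) * ((-1) ^ d * tilde d f (supp u)))"
  proof (rule sum.cong[OF refl])
    fix u :: "'b^'n"
    have "card (- supp u) = CARD('n) - wt u"
      by (simp add: wt_def Compl_eq_Diff_UNIV card_Diff_subset)
    then show "(\<Sum>X | X \<in> E_sets t \<and> X \<subseteq> - supp u. tilde d f X)
        = ?c (wt u) * ((-1) ^ d * tilde d f (supp u))"
      using sum_tilde_subsets[OF d(2), of f "- supp u"] by (simp add: tilde_Compl[OF f])
  qed
  \<comment> \<open>The zero word, excluded by the \<open>- 1\<close> in \<open>B_set\<close>, can be put back: \<open>d \<ge> 1\<close> and its support is empty.\<close>
  also have "\<dots> = (\<Sum>u\<in>?D. ?c (wt u) * ((-1) ^ d * tilde d f (supp u)))"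
  proof -
    have "tilde d f (supp (0 :: 'b^'n)) = 0"
      using d(1) by (intro tilde_eq_0_if_card_less) (simp add: supp_def)
    then show ?thesis by (intro sum.mono_neutral_left) auto
  qed
  also have "\<dots> = (\<Sum>i\<le>CARD('n). \<Sum>u | u \<in> ?D \<and> wt u = i.
      ?c (wt u) * ((-1) ^ d * tilde d f (supp u)))"
    by (rule sum.group[symmetric]) (auto simp: wt_def intro: card_mono)
  also have "\<dots> = (\<Sum>i\<le>CARD('n). (-1) ^ d * (?c i * A_coeff \<iota> d C f i))"
    by (intro sum.cong refl) (simp add: A_coeff_def sum_distrib_left mult_ac)
  also have "\<dots> = (\<Sum>i = d..CARD('n) - d. (-1) ^ d * (?c i * A_coeff \<iota> d C f i))"
  proof (intro sum.mono_neutral_right ballI)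
    fix i assume "i \<in> {..CARD('n)} - {d..CARD('n) - d}"
    then have "A_coeff \<iota> d C f i = 0"
      by (intro A_coeff_eq_0[OF f]) auto
    then show "(-1) ^ d * (?c i * A_coeff \<iota> d C f i) = 0" by simp
  qed auto
  also have "\<dots> = (-1) ^ d * (\<Sum>i = d..CARD('n) - d. ?c i * A_coeff \<iota> d C f i)"
    by (simp add: sum_distrib_left)
  finally show ?thesis
    by (simp add: flip: mult.assoc power_mult_distrib)
qed

text \<open>
  The binomial theorem for \<open>(x - y) + y\<close>, homogenized to degree \<open>M\<close>. The summation range does not depend
  on \<open>N\<close>, so identities for several \<open>N\<close> can be combined under one sum over \<open>k\<close>.
\<close>

lemma binomial_padded:
  fixes x y :: "'a::comm_ring_1"
  assumes "N \<le> M"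
  shows "(\<Sum>k\<le>M. of_nat (N choose k) * (x - y) ^ k * y ^ (M - k)) = x ^ N * y ^ (M - N)"
proof -
  have "(\<Sum>k\<le>M. of_nat (N choose k) * (x - y) ^ k * y ^ (M - k))
      = (\<Sum>k\<le>N. of_nat (N choose k) * (x - y) ^ k * y ^ (M - k))"
    using assms by (intro sum.mono_neutral_right) (auto simp: binomial_eq_0)
  also have "\<dots> = (\<Sum>k\<le>N. of_nat (N choose k) * (x - y) ^ k * y ^ (N - k)) * y ^ (M - N)"
    unfolding sum_distrib_right using assms
    by (intro sum.cong) (auto simp: mult.assoc simp flip: power_add)
  also have "\<dots> = x ^ N * y ^ (M - N)"
    by (simp flip: binomial_ring)
  finally show ?thesis .
qed

theorem theorem3p4:
  fixes \<iota> :: "'a::{field,finite} \<Rightarrow> 'b::{field,finite}"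
    and C :: "('a^'n::finite) set"
    and f :: "'n set \<Rightarrow> real"
    and d m q :: nat
  assumes "q = CARD('a)"
    and "m \<ge> 1"
    and "CARD('b) = q ^ m"
    and "field_embedding \<iota>"
    and "vec.subspace C"
    and "1 \<le> d" and "d \<le> CARD('n)"
    and "f \<in> Harm d"
  shows "Z_poly \<iota> d C f =
    (-1) ^ d * (\<Sum>t = d..CARD('n) - d.
      pconst (B_coeff (q ^ m) d C f t) * (pvar_x - pvar_y) ^ (t - d) * pvar_y ^ (CARD('n) - t - d))"
proof -
  let ?n = "CARD('n)"
  let ?A = "A_coeff \<iota> d C f" and ?B = "B_coeff (q ^ m) d C f"
  let ?v = "\<lambda>t. (pvar_x - pvar_y) ^ (t - d) * pvar_y ^ (?n - t - d)"
  have pconst_mult: "pconst (a * b) = pconst a * pconst b" for a b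
    by simp
  have pconst_sum: "pconst (sum g I) = (\<Sum>i\<in>I. pconst (g i))" for g :: "nat \<Rightarrow> real" and I
  proof (induction I rule: infinite_finite_induct)
    case (insert i I)
    have "pconst (g i + sum g I) = pconst (g i) + pconst (sum g I)" by simp
    with insert show ?case by (simp only: sum.insert not_False_eq_True)
  qed auto
  have pconst_nat: "pconst (real k) = of_nat k" for k
    by (simp add: of_nat_poly)
  have pconst_sign: "pconst ((-1) ^ d * a) = (-1) ^ d * pconst a" for a
    by (cases "even d") auto
  have B: "(-1) ^ d * pconst (?B t) = (\<Sum>i = d..?n - d. of_nat ((?n - i - d) choose (t - d)) * pconst (?A i))"
    if "t \<in> {d..?n - d}" for t
  proof -
    have "(-1) ^ d * ?B t = (\<Sum>i = d..?n - d. real ((?n - i - d) choose (t - d)) * ?A i)"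
      using B_coeff_eq_sum_A_coeff[of \<iota> C d t f] assms that by simp
    then show ?thesis
      by (simp only: pconst_sum pconst_mult pconst_nat flip: pconst_sign)
  qed
  have binom: "(\<Sum>t = d..?n - d. of_nat ((?n - i - d) choose (t - d)) * ?v t)
      = pvar_x ^ (?n - i - d) * pvar_y ^ (i - d)" if "i \<in> {d..?n - d}" for i
  proof -
    \<comment> \<open>\<open>i\<close> exists only if \<open>2 * d \<le> n\<close>; then all the differences below are genuine.\<close>
    let ?M = "?n - 2 * d"
    have "(\<Sum>t = d..?n - d. of_nat ((?n - i - d) choose (t - d)) * ?v t)
        = (\<Sum>k\<le>?M. of_nat ((?n - i - d) choose k) * (pvar_x - pvar_y) ^ k * pvar_y ^ (?M - k))"
      using that
      by (intro sum.reindex_bij_witness[where i = "\<lambda>k. k + d" and j = "\<lambda>t. t - d"])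
        (auto simp: mult.assoc intro!: arg_cong2[where f = "(*)"] arg_cong2[where f = "(^)"])
    also have "\<dots> = pvar_x ^ (?n - i - d) * pvar_y ^ (?M - (?n - i - d))"
      using that by (intro binomial_padded) auto
    also have "?M - (?n - i - d) = i - d"
      using that by auto
    finally show ?thesis .
  qed
  have "(-1) ^ d * (\<Sum>t = d..?n - d. pconst (?B t) * (pvar_x - pvar_y) ^ (t - d) * pvar_y ^ (?n - t - d))
      = (\<Sum>t = d..?n - d. ((-1) ^ d * pconst (?B t)) * ?v t)"
    by (simp only: sum_distrib_left mult.assoc)
  also have "\<dots> = (\<Sum>t = d..?n - d. \<Sum>i = d..?n - d.
      pconst (?A i) * (of_nat ((?n - i - d) choose (t - d)) * ?v t))"
    by (intro sum.cong refl) (simp only: B sum_distrib_right, simp only: mult_ac)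
  also have "\<dots> = (\<Sum>i = d..?n - d. pconst (?A i) *
      (\<Sum>t = d..?n - d. of_nat ((?n - i - d) choose (t - d)) * ?v t))"
    unfolding sum_distrib_left by (rule sum.swap)
  also have "\<dots> = (\<Sum>i = d..?n - d. pconst (?A i) * (pvar_x ^ (?n - i - d) * pvar_y ^ (i - d)))"
    by (intro sum.cong refl) (simp only: binom)
  also have "\<dots> = Z_poly \<iota> d C f"
    by (simp only: Z_poly_def mult.assoc)
  finally show ?thesis by (rule sym)
qed

end
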